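(* Let $f\colon \mathbb{N} \to \mathbb{N}$ be a non-decreasing function that majorizes the identity function (that is, $f(n) \geq n$ for all $n$), and let $\{\chi \leq f(\omega)\}$ denote the graph class $\{ H \mid \chi(H) \leq f(\omega(H)) \}$. Then for all graphs $G$, $$c_{\{\chi \leq f(\omega)\}}(G) = \left\lceil \frac{\log \chi(G)}{\log f(\omega(G))} \right\rceil.$$
   Context: $\chi$ denotes the chromatic number and $\omega$ the clique number. Logarithms are to base 2. For a class of graphs $\mathcal{P}$, a covering of a graph $G$ by graphs of class $\mathcal{P}$ is an expression $E(G) = E(G_1) \cup \dots \cup E(G_k)$ of the edge set of $G$ as the union of the edge sets of graphs $G_1, \dots, G_k$ with $G_i \in \mathcal{P}$ for all $i \in \{1, \dots, k\}$. The cover number $c_{\mathcal{P}}(G)$ is the smallest $k$ such that $G$ admits a covering by $k$ graphs of class $\mathcal{P}$. *)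

theory Defs
  imports Complex_Main "HOL-Library.Ramsey"
begin

datatype 'a graph = Graph (verts: "'a set") (edges: "'a set set")

definition simple_graph :: "'a graph \<Rightarrow> bool" where
  "simple_graph G \<longleftrightarrow> finite (verts G) \<and> edges G \<subseteq> [verts G]\<^bsup>2\<^esup>"

definition proper_coloring :: "'a graph \<Rightarrow> nat \<Rightarrow> ('a \<Rightarrow> nat) \<Rightarrow> bool" where
  "proper_coloring G k c \<longleftrightarrow>
     c ` verts G \<subseteq> {..<k} \<and> (\<forall>u v. {u, v} \<in> edges G \<longrightarrow> c u \<noteq> c v)"

definition chromatic_number :: "'a graph \<Rightarrow> nat" where
  "chromatic_number G = (LEAST k. \<exists>c. proper_coloring G k c)"

definition is_clique :: "'a graph \<Rightarrow> 'a set \<Rightarrow> bool" where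
  "is_clique G K \<longleftrightarrow> K \<subseteq> verts G \<and> [K]\<^bsup>2\<^esup> \<subseteq> edges G"

definition clique_number :: "'a graph \<Rightarrow> nat" where
  "clique_number G = Max (card ` {K. is_clique G K})"

text \<open>The vertex sets of the covering graphs are not constrained beyond what the edge equation
  forces; \<open>k = 0\<close> is allowed, so that an edgeless graph has cover number 0.\<close>

definition is_covering :: "'a graph set \<Rightarrow> 'a graph \<Rightarrow> nat \<Rightarrow> (nat \<Rightarrow> 'a graph) \<Rightarrow> bool" where
  "is_covering P G k H \<longleftrightarrow>
     (\<forall>i\<in>{1..k}. H i \<in> P) \<and> edges G = (\<Union>i\<in>{1..k}. edges (H i))"

text \<open>Only meaningful if \<open>G\<close> has a finite covering by members of \<open>P\<close>.\<close>

definition cover_number :: "'a graph set \<Rightarrow> 'a graph \<Rightarrow> nat" where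
  "cover_number P G = (LEAST k. \<exists>H. is_covering P G k H)"

definition chi_bounded_class :: "(nat \<Rightarrow> nat) \<Rightarrow> 'a graph set" where
  "chi_bounded_class f = {H. simple_graph H \<and> chromatic_number H \<le> f (clique_number H)}"

end

theory Submission
  imports Defs
begin

text \<open>
  Write \<open>b = f (\<omega>(G))\<close>. The formula is the arithmetical form of the equivalence that \<open>G\<close> has a
  covering by \<open>k\<close> graphs of the class if and only if \<open>\<chi>(G) \<le> b ^ k\<close> (lemma
  \<open>covering_iff_chromatic_number_le_power\<close>); the least such \<open>k\<close> is the ceiling of
  \<open>log \<chi>(G) / log b\<close>.

  Given a covering by \<open>H 1, \<dots>, H k\<close>, no \<open>H i\<close> has a larger clique than \<open>G\<close>, so monotonicity of \<open>f\<close>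
  gives each a proper colouring with \<open>b\<close> colours. Every edge of \<open>G\<close> is an edge of some \<open>H i\<close>, so the
  vector of these colours is a proper colouring of \<open>G\<close> with \<open>b ^ k\<close> colours.

  Conversely, colour \<open>G\<close> properly by words of length \<open>k\<close> over \<open>b\<close> letters and let \<open>H i\<close> consist of
  the edges whose ends have words that differ at position \<open>i\<close>. These graphs cover \<open>G\<close>, and the
  letters at position \<open>i\<close> colour \<open>H i\<close> with \<open>b\<close> colours. The danger is that \<open>\<omega>(H i)\<close>, hence
  \<open>f (\<omega>(H i))\<close>, is too small. Since \<open>\<omega>(G) \<le> b\<close>, the vertices of a maximum clique of \<open>G\<close> can be
  assigned distinct constant words, and permuting the colours makes any proper colouring agree with
  this assignment (lemma \<open>coloring_extending_clique\<close>). Then the maximum clique survives in every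
  \<open>H i\<close>, and \<open>\<chi>(H i) \<le> b \<le> f (\<omega>(H i))\<close>.
\<close>

section \<open>Colourings with an arbitrary set of colours\<close>

definition proper_on_edges :: "'a graph \<Rightarrow> ('a \<Rightarrow> 'c) \<Rightarrow> bool" where
  "proper_on_edges G g \<longleftrightarrow> (\<forall>u v. {u, v} \<in> edges G \<longrightarrow> g u \<noteq> g v)"

lemma simple_graph_edgeE:
  assumes "simple_graph G" "E \<in> edges G"
  obtains u v where "E = {u, v}" "u \<noteq> v" "u \<in> verts G" "v \<in> verts G"
  using assms unfolding simple_graph_def nsets_def by (auto simp: card_2_iff)

lemma simple_graph_edge_verts:
  assumes "simple_graph G" "{u, v} \<in> edges G"
  shows "u \<in> verts G" "v \<in> verts G" "u \<noteq> v"
  using simple_graph_edgeE[OF assms] assms(1)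
  by (auto simp: doubleton_eq_iff)

lemma proper_on_edges_comp:
  assumes "simple_graph G" "proper_on_edges G g" "inj_on h (g ` verts G)"
  shows "proper_on_edges G (h \<circ> g)"
  using assms simple_graph_edge_verts[OF assms(1)]
  unfolding proper_on_edges_def inj_on_def by (metis comp_apply imageI)

lemma chromatic_number_le_card:
  assumes "simple_graph G" "finite S" "g ` verts G \<subseteq> S" "proper_on_edges G g"
  shows "chromatic_number G \<le> card S"
proof -
  obtain h where h: "bij_betw h S {..<card S}"
    using ex_bij_betw_finite_nat[OF assms(2)] by (auto simp: atLeast0LessThan)
  have "proper_on_edges G (h \<circ> g)"
    using assms h by (intro proper_on_edges_comp) (auto simp: bij_betw_def intro: inj_on_subset)
  moreover have "(h \<circ> g) ` verts G \<subseteq> {..<card S}"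
    using h assms(3) by (auto simp: bij_betw_def)
  ultimately have "proper_coloring G (card S) (h \<circ> g)"
    by (simp add: proper_coloring_def proper_on_edges_def)
  then show ?thesis
    unfolding chromatic_number_def by (blast intro: Least_le)
qed

lemma coloring_of_chromatic_number_le_card:
  assumes "simple_graph G" "finite S" "chromatic_number G \<le> card S"
  obtains g where "g ` verts G \<subseteq> S" "proper_on_edges G g"
proof -
  have "finite (verts G)"
    using assms(1) by (simp add: simple_graph_def)
  then obtain h where h: "bij_betw h (verts G) {..<card (verts G)}"
    using ex_bij_betw_finite_nat by (auto simp: atLeast0LessThan)
  \<comment> \<open>Some colouring exists, so that the minimum defining the chromatic number is attained.\<close>
  then have "proper_coloring G (card (verts G)) h"
    using simple_graph_edge_verts[OF assms(1)]
    unfolding proper_coloring_def bij_betw_def by (metis inj_onD order_refl)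
  then obtain c where c: "proper_coloring G (chromatic_number G) c"
    unfolding chromatic_number_def using LeastI_ex[of "\<lambda>k. \<exists>c. proper_coloring G k c"] by blast
  obtain p where p: "inj_on p {..<chromatic_number G}" "p ` {..<chromatic_number G} \<subseteq> S"
    using card_le_inj[of "{..<chromatic_number G}" S] assms by auto
  have cV: "c ` verts G \<subseteq> {..<chromatic_number G}" and "proper_on_edges G c"
    using c by (auto simp: proper_coloring_def proper_on_edges_def)
  then have "proper_on_edges G (p \<circ> c)"
    using assms(1) p(1) by (intro proper_on_edges_comp) (auto intro: inj_on_subset)
  moreover have "(p \<circ> c) ` verts G \<subseteq> S"
    using p(2) cV by fastforce
  ultimately show thesis by (rule that[rotated])
qed

section \<open>Cliques\<close>

lemma clique_edge:
  assumes "is_clique G K" "u \<in> K" "v \<in> K" "u \<noteq> v"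
  shows "{u, v} \<in> edges G"
  using assms by (auto simp: is_clique_def nsets_def)

lemma is_cliqueI:
  assumes "K \<subseteq> verts G" "\<And>u v. u \<in> K \<Longrightarrow> v \<in> K \<Longrightarrow> u \<noteq> v \<Longrightarrow> {u, v} \<in> edges G"
  shows "is_clique G K"
  using assms by (auto simp: is_clique_def nsets_def card_2_iff)

lemma finite_cliques:
  assumes "simple_graph G"
  shows "finite {K. is_clique G K}"
  using assms by (auto simp: simple_graph_def is_clique_def intro: finite_subset[of _ "Pow (verts G)"])

lemma card_clique_le_clique_number:
  assumes "simple_graph G" "is_clique G K"
  shows "card K \<le> clique_number G"
  using assms finite_cliques[of G] unfolding clique_number_def by (intro Max_ge) auto

lemma maximum_cliqueE:
  assumes "simple_graph G"
  obtains K where "is_clique G K" "card K = clique_number G"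
proof -
  have "is_clique G {}"
    by (auto intro: is_cliqueI)
  then have "clique_number G \<in> card ` {K. is_clique G K}"
    using finite_cliques[OF assms] unfolding clique_number_def by (intro Max_in) auto
  then show thesis
    using that by auto
qed

lemma clique_number_pos:
  assumes "simple_graph G" "verts G \<noteq> {}"
  shows "1 \<le> clique_number G"
proof -
  obtain v where "v \<in> verts G" using assms(2) by auto
  then have "is_clique G {v}" by (auto intro: is_cliqueI)
  then show ?thesis using card_clique_le_clique_number[OF assms(1)] by fastforce
qed

lemma clique_number_ge_2:
  assumes "simple_graph G" "edges G \<noteq> {}"
  shows "2 \<le> clique_number G"
proof -
  obtain u v where uv: "{u, v} \<in> edges G" "u \<noteq> v" "u \<in> verts G" "v \<in> verts G"
    using assms by (metis ex_in_conv simple_graph_edgeE)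
  then have "is_clique G {u, v}" by (auto intro: is_cliqueI simp: insert_commute)
  then show ?thesis using card_clique_le_clique_number[OF assms(1)] uv(2) by fastforce
qed

text \<open>The vertices of \<open>H\<close> need not belong to \<open>G\<close>. An isolated vertex outside \<open>G\<close> is a clique of
  size 1, which is why \<open>G\<close> must have a vertex; every vertex of a larger clique of \<open>H\<close> lies on an edge
  and hence in \<open>G\<close>.\<close>

lemma clique_number_mono_edges:
  assumes G: "simple_graph G" and H: "simple_graph H"
    and sub: "edges H \<subseteq> edges G" and ne: "verts G \<noteq> {}"
  shows "clique_number H \<le> clique_number G"
proof -
  obtain K where K: "is_clique H K" "card K = clique_number H"
    using maximum_cliqueE[OF H] .
  show ?thesis
  proof (cases "card K \<le> 1")
    case True
    then show ?thesis using K(2) clique_number_pos[OF G ne] by simp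
  next
    case False
    have "is_clique G K"
    proof (rule is_cliqueI)
      show "{u, v} \<in> edges G" if "u \<in> K" "v \<in> K" "u \<noteq> v" for u v
        using clique_edge[OF K(1) that] sub by auto
      show "K \<subseteq> verts G"
      proof
        fix v assume "v \<in> K"
        then obtain u where "u \<in> K" "u \<noteq> v"
          using False by (metis One_nat_def card_le_Suc0_iff_eq card.infinite zero_le_one)
        then have "{u, v} \<in> edges G"
          using \<open>v \<in> K\<close> clique_edge[OF K(1)] sub by auto
        then show "v \<in> verts G" using simple_graph_edge_verts(2)[OF G] by blast
      qed
    qed
    then show ?thesis using card_clique_le_clique_number[OF G] K(2) by metis
  qed
qed

section \<open>Prescribing the colours of a clique\<close>

lemma inj_on_extend:
  assumes "finite A" "finite B" "card A \<le> card B"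
    and "C \<subseteq> A" "inj_on g C" "g ` C \<subseteq> B"
  obtains h where "inj_on h A" "h ` A \<subseteq> B" "\<And>x. x \<in> C \<Longrightarrow> h x = g x"
proof -
  have "finite C" using assms finite_subset by blast
  then have "card (A - C) \<le> card (B - g ` C)"
    using assms by (simp add: card_Diff_subset card_image)
  then obtain p where p: "inj_on p (A - C)" "p ` (A - C) \<subseteq> B - g ` C"
    using card_le_inj[of "A - C" "B - g ` C"] assms by auto
  define h where "h x = (if x \<in> C then g x else p x)" for x
  have "inj_on h A"
  proof (rule inj_onI)
    fix x y assume xy: "x \<in> A" "y \<in> A" and eq: "h x = h y"
    have outside: "h z \<notin> g ` C" if "z \<in> A" "z \<notin> C" for z
      using that p(2) by (auto simp: h_def)
    have "x \<in> C \<longleftrightarrow> y \<in> C"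
      using eq xy outside by (metis h_def imageI)
    then show "x = y"
      using eq xy inj_onD[OF assms(5)] inj_onD[OF p(1)] by (auto simp: h_def split: if_splits)
  qed
  moreover have "h ` A \<subseteq> B"
    using p assms(6) unfolding h_def by auto
  ultimately show thesis
    using that h_def by simp
qed

text \<open>A proper colouring is injective on a clique, so a permutation of the colour set turns the
  colours that it gives to the clique into the prescribed ones.\<close>

lemma coloring_extending_clique:
  assumes G: "simple_graph G" and S: "finite S" "chromatic_number G \<le> card S"
    and K: "is_clique G K" and e: "inj_on e K" "e ` K \<subseteq> S"
  obtains g where "g ` verts G \<subseteq> S" "proper_on_edges G g" "\<And>v. v \<in> K \<Longrightarrow> g v = e v"
proof -
  obtain c where c: "c ` verts G \<subseteq> S" "proper_on_edges G c"
    using coloring_of_chromatic_number_le_card[OF G S] .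
  have KV: "K \<subseteq> verts G" using K by (simp add: is_clique_def)
  have inj: "inj_on c K"
    using c(2) clique_edge[OF K] unfolding proper_on_edges_def inj_on_def by blast
  have "inj_on (e \<circ> inv_into K c) (c ` K)"
    using inj e(1) by (auto simp: inj_on_def)
  moreover have "(e \<circ> inv_into K c) ` (c ` K) \<subseteq> S"
    using inj e(2) by auto
  ultimately obtain h where h: "inj_on h S" "h ` S \<subseteq> S"
    "\<And>x. x \<in> c ` K \<Longrightarrow> h x = (e \<circ> inv_into K c) x"
    using inj_on_extend[of S S "c ` K" "e \<circ> inv_into K c"] S(1) c(1) KV
    by (metis image_mono order_refl order_trans)
  show thesis
  proof
    show "(h \<circ> c) ` verts G \<subseteq> S" using h(2) c(1) by fastforce
    show "proper_on_edges G (h \<circ> c)"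
      using G c h(1) by (intro proper_on_edges_comp) (auto intro: inj_on_subset)
    show "(h \<circ> c) v = e v" if "v \<in> K" for v
      using that h(3) inj by auto
  qed
qed

section \<open>Coverings and powers\<close>

lemma chromatic_number_le_1_iff:
  assumes "simple_graph G"
  shows "chromatic_number G \<le> 1 \<longleftrightarrow> edges G = {}"
proof
  assume "chromatic_number G \<le> 1"
  then obtain g :: "'a \<Rightarrow> nat" where g: "g ` verts G \<subseteq> {0}" "proper_on_edges G g"
    using coloring_of_chromatic_number_le_card[OF assms, of "{0::nat}"] by auto
  show "edges G = {}"
  proof (rule ccontr)
    assume "edges G \<noteq> {}"
    then obtain u v where "{u, v} \<in> edges G" "u \<in> verts G" "v \<in> verts G"
      using assms by (metis ex_in_conv simple_graph_edgeE)
    then show False using g unfolding proper_on_edges_def by (metis image_subset_iff singletonD)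
  qed
next
  assume "edges G = {}"
  then show "chromatic_number G \<le> 1"
    using chromatic_number_le_card[OF assms, of "{0::nat}" "\<lambda>_. 0"]
    by (auto simp: proper_on_edges_def)
qed

lemma chromatic_number_le_power_of_covering:
  assumes f: "mono f" "\<And>n. n \<le> f n" and G: "simple_graph G"
    and cov: "is_covering (chi_bounded_class f) G k H"
  shows "chromatic_number G \<le> f (clique_number G) ^ k"
proof (cases "verts G = {}")
  case True
  then have "chromatic_number G \<le> card ({} :: nat set)"
    using simple_graph_edge_verts[OF G]
    by (intro chromatic_number_le_card[OF G, where g = "\<lambda>_. 0"]) (auto simp: proper_on_edges_def)
  then show ?thesis by simp
next
  case False
  define b where "b = f (clique_number G)"
  have b: "0 < b"
    using clique_number_pos[OF G False] f(2)[of "clique_number G"] by (simp add: b_def)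
  have edges: "edges G = (\<Union>i\<in>{1..k}. edges (H i))"
    using cov by (simp add: is_covering_def)
  have "\<exists>g. g ` verts (H i) \<subseteq> {..<b} \<and> proper_on_edges (H i) g" if i: "i \<in> {1..k}" for i
  proof -
    have Hi: "simple_graph (H i)" "chromatic_number (H i) \<le> f (clique_number (H i))"
      using cov i by (auto simp: is_covering_def chi_bounded_class_def)
    have "clique_number (H i) \<le> clique_number G"
      using edges i by (intro clique_number_mono_edges[OF G Hi(1) _ False]) auto
    then have "chromatic_number (H i) \<le> card {..<b}"
      using Hi(2) monoD[OF f(1)] by (fastforce simp: b_def)
    then show ?thesis
      using coloring_of_chromatic_number_le_card[OF Hi(1), of "{..<b}"] by blast
  qed
  then obtain g where g: "\<And>i. i \<in> {1..k} \<Longrightarrow> g i ` verts (H i) \<subseteq> {..<b}"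
    "\<And>i. i \<in> {1..k} \<Longrightarrow> proper_on_edges (H i) (g i)"
    by metis
  \<comment> \<open>A vertex of \<open>G\<close> may be missing from \<open>H i\<close>; it then gets the dummy colour 0.\<close>
  define w where "w v = (\<lambda>i\<in>{1..k}. if v \<in> verts (H i) then g i v else 0)" for v
  have "w ` verts G \<subseteq> {1..k} \<rightarrow>\<^sub>E {..<b}"
    using g(1) b by (auto simp: w_def image_subset_iff)
  moreover have "proper_on_edges G w"
    unfolding proper_on_edges_def
  proof (intro allI impI)
    fix u v assume "{u, v} \<in> edges G"
    then obtain i where i: "i \<in> {1..k}" and uv: "{u, v} \<in> edges (H i)"
      using edges by auto
    have "simple_graph (H i)"
      using cov i by (auto simp: is_covering_def chi_bounded_class_def)
    then have "u \<in> verts (H i)" "v \<in> verts (H i)"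
      using simple_graph_edge_verts(1,2)[OF _ uv] by simp_all
    then have "w u i = g i u" "w v i = g i v"
      using i by (auto simp: w_def)
    moreover have "g i u \<noteq> g i v"
      using g(2)[OF i] uv by (simp add: proper_on_edges_def)
    ultimately show "w u \<noteq> w v" by metis
  qed
  ultimately have "chromatic_number G \<le> card ({1..k} \<rightarrow>\<^sub>E {..<b})"
    by (intro chromatic_number_le_card[OF G]) (auto intro: finite_PiE)
  then show ?thesis by (simp add: card_PiE b_def)
qed

lemma covering_of_chromatic_number_le_power:
  assumes f: "mono f" "\<And>n. n \<le> f n" and G: "simple_graph G"
    and le: "chromatic_number G \<le> f (clique_number G) ^ k"
  shows "\<exists>H. is_covering (chi_bounded_class f) G k H"
proof (cases "k = 0")
  case True
  then have "edges G = {}"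
    using le chromatic_number_le_1_iff[OF G] by simp
  then show ?thesis using True by (simp add: is_covering_def)
next
  case False
  define b where "b = f (clique_number G)"
  define W where "W = ({1..k} \<rightarrow>\<^sub>E {..<b})"
  have W: "finite W" "chromatic_number G \<le> card W"
    using le by (auto simp: W_def b_def card_PiE intro: finite_PiE)
  obtain K where K: "is_clique G K" "card K = clique_number G"
    using maximum_cliqueE[OF G] .
  have "finite K"
    using K(1) G by (auto simp: is_clique_def simple_graph_def intro: finite_subset)
  then obtain e where e: "inj_on e K" "e ` K \<subseteq> {..<b}"
    using card_le_inj[of K "{..<b}"] K(2) f(2)[of "clique_number G"] by (auto simp: b_def)
  define const where "const v = (\<lambda>i\<in>{1..k}. e v)" for v
  have const: "const v i = e v" if "i \<in> {1..k}" for v i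
    using that by (simp add: const_def)
  \<comment> \<open>Constant words determine their letter because \<open>k\<close> is positive.\<close>
  have "inj_on const K"
    using False e(1) const[of 1] unfolding inj_on_def by (metis One_nat_def Suc_leI atLeastAtMost_iff neq0_conv order_refl)
  moreover have "const ` K \<subseteq> W"
    using e(2) by (auto simp: const_def W_def)
  ultimately obtain g where g: "g ` verts G \<subseteq> W" "proper_on_edges G g"
    "\<And>v. v \<in> K \<Longrightarrow> g v = const v"
    using coloring_extending_clique[OF G W K(1)] by metis
  define H where "H i = Graph (verts G) {E \<in> edges G. \<exists>u v. E = {u, v} \<and> g u i \<noteq> g v i}" for i
  have V: "verts (H i) = verts G" for i
    by (simp add: H_def)
  have E: "{u, v} \<in> edges (H i) \<longleftrightarrow> {u, v} \<in> edges G \<and> g u i \<noteq> g v i" for u v i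
    by (auto simp: H_def doubleton_eq_iff)
  have simple: "simple_graph (H i)" for i
    using G by (auto simp: H_def simple_graph_def)
  have "H i \<in> chi_bounded_class f" if i: "i \<in> {1..k}" for i
  proof -
    have "is_clique (H i) K"
    proof (rule is_cliqueI)
      show "K \<subseteq> verts (H i)" using K(1) by (simp add: V is_clique_def)
      show "{u, v} \<in> edges (H i)" if "u \<in> K" "v \<in> K" "u \<noteq> v" for u v
        using that clique_edge[OF K(1)] e(1) g(3) const[OF i] by (simp add: E inj_on_eq_iff)
    qed
    then have "b \<le> f (clique_number (H i))"
      using card_clique_le_clique_number[OF simple] K(2) monoD[OF f(1)] unfolding b_def by metis
    moreover have "chromatic_number (H i) \<le> card {..<b}"
    proof (rule chromatic_number_le_card[OF simple])
      show "(\<lambda>v. g v i) ` verts (H i) \<subseteq> {..<b}"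
        using g(1) i by (force simp: V W_def image_subset_iff)
      show "proper_on_edges (H i) (\<lambda>v. g v i)"
        by (simp add: proper_on_edges_def E)
    qed simp
    ultimately show ?thesis
      using simple by (simp add: chi_bounded_class_def)
  qed
  moreover have "edges G = (\<Union>i\<in>{1..k}. edges (H i))"
  proof
    show "(\<Union>i\<in>{1..k}. edges (H i)) \<subseteq> edges G" by (auto simp: H_def)
    show "edges G \<subseteq> (\<Union>i\<in>{1..k}. edges (H i))"
    proof
      fix E' assume E': "E' \<in> edges G"
      then obtain u v where uv: "E' = {u, v}" "u \<in> verts G" "v \<in> verts G"
        using simple_graph_edgeE[OF G] by metis
      have "g u \<noteq> g v" using g(2) E' uv(1) by (simp add: proper_on_edges_def)
      moreover have "g u \<in> W" "g v \<in> W" using g(1) uv by auto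
      ultimately obtain i where "i \<in> {1..k}" "g u i \<noteq> g v i"
        unfolding W_def by (meson PiE_ext)
      then show "E' \<in> (\<Union>i\<in>{1..k}. edges (H i))" using E' uv(1) E by blast
    qed
  qed
  ultimately have "is_covering (chi_bounded_class f) G k H"
    by (simp add: is_covering_def)
  then show ?thesis by blast
qed

lemma covering_iff_chromatic_number_le_power:
  assumes "mono f" "\<And>n. n \<le> f n" "simple_graph G"
  shows "(\<exists>H. is_covering (chi_bounded_class f) G k H) \<longleftrightarrow>
    chromatic_number G \<le> f (clique_number G) ^ k"
  using chromatic_number_le_power_of_covering[OF assms]
    covering_of_chromatic_number_le_power[OF assms] by blast

section \<open>The cover number as a ceiling\<close>

lemma Least_power_eq_ceiling_log:
  fixes b n :: nat
  assumes b: "2 \<le> b" and n: "1 \<le> n"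
  shows "int (LEAST k. n \<le> b ^ k) = \<lceil>log 2 n / log 2 b\<rceil>"
proof -
  have eq: "n \<le> b ^ k \<longleftrightarrow> log 2 n / log 2 b \<le> k" for k
  proof -
    have "n \<le> b ^ k \<longleftrightarrow> real n \<le> real b ^ k"
      by (metis of_nat_le_iff of_nat_power)
    also have "\<dots> \<longleftrightarrow> log 2 n \<le> log 2 (real b ^ k)"
      using b n by (intro log_le_cancel_iff[symmetric]) auto
    also have "\<dots> \<longleftrightarrow> log 2 n / log 2 b \<le> k"
      using b by (simp add: log_nat_power pos_divide_le_eq)
    finally show ?thesis .
  qed
  have nn: "0 \<le> log 2 n / log 2 b"
    using b n by simp
  have "(LEAST k. n \<le> b ^ k) = nat \<lceil>log 2 n / log 2 b\<rceil>"
    unfolding eq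
  proof (rule Least_equality)
    show "log 2 n / log 2 b \<le> real (nat \<lceil>log 2 n / log 2 b\<rceil>)"
      by (rule real_nat_ceiling_ge)
    show "nat \<lceil>log 2 n / log 2 b\<rceil> \<le> k" if "log 2 n / log 2 b \<le> real k" for k
      using that by (simp add: ceiling_le_iff)
  qed
  then show ?thesis using nn by simp
qed

text \<open>An edgeless graph has \<open>\<chi>(G) \<le> 1\<close>. Since \<open>log 2 0 = log 2 1 = 0\<close>, the quotient vanishes
  whatever its denominator, in agreement with the empty covering.\<close>

theorem theorem3:
  fixes f :: "nat \<Rightarrow> nat" and G :: "'a graph"
  assumes "mono f"
    and "\<And>n. n \<le> f n"
    and "simple_graph G"
  shows "int (cover_number (chi_bounded_class f) G) =
    \<lceil>log 2 (real (chromatic_number G)) / log 2 (real (f (clique_number G)))\<rceil>"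
proof (cases "edges G = {}")
  case True
  then have "chromatic_number G = 0 \<or> chromatic_number G = 1"
    using chromatic_number_le_1_iff[OF assms(3)] by linarith
  then have "log 2 (real (chromatic_number G)) = 0" by (auto simp: log_def)
  moreover have "cover_number (chi_bounded_class f) G = 0"
    unfolding cover_number_def using True by (intro Least_eq_0) (auto simp: is_covering_def)
  ultimately show ?thesis by simp
next
  case False
  have "2 \<le> f (clique_number G)"
    using clique_number_ge_2[OF assms(3) False] assms(2) le_trans by blast
  moreover have "1 \<le> chromatic_number G"
    using chromatic_number_le_1_iff[OF assms(3)] False by linarith
  ultimately show ?thesis
    unfolding cover_number_def covering_iff_chromatic_number_le_power[OF assms]
    by (rule Least_power_eq_ceiling_log)
qed

end
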